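(* Let $V=[n]$, $k\ge1$, $\varepsilon\in(0,1)$, $B$ a positive integer with $B\le n$, and let $F:(k+1)^V\to\mathbb{R}_{\ge0}$ be $\varepsilon$-approximately diminishing returns. Let $\mathbf{x}$ be the output of $k$-Greedy-TS applied to $F$ and $B$. Then $F(\mathbf{x})\ge\frac{1-\varepsilon}{2}\max_{\mathbf{y}\in(k+1)^V,\ |\mathrm{supp}(\mathbf{y})|\le B}F(\mathbf{y})$.
   Context: $(k+1)^V$ is the set of $k$-tuples $\mathbf{x}=(X_1,\dots,X_k)$ of pairwise disjoint subsets of $V$ (identified with $\mathbf{x}\in\{0,\dots,k\}^V$, $\mathbf{x}(e)=i\iff e\in X_i$); $\mathbf{0}$ is the all-empty tuple; $\mathrm{supp}(\mathbf{x})=\bigcup_iX_i$; $\mathbf{x}\preceq\mathbf{y}$ iff $X_i\subseteq Y_i$ $\forall i$; $\Delta_{u,i}g(\mathbf{x})=g(X_1,\dots,X_i\cup\{u\},\dots,X_k)-g(\mathbf{x})$ for $u\notin\mathrm{supp}(\mathbf{x})$. $f$ is $k$-submodular if $\Delta_{u,i}f(\mathbf{x})\ge\Delta_{u,i}f(\mathbf{y})$ for $\mathbf{x}\preceq\mathbf{y}$, $u\notin\mathrm{supp}(\mathbf{y})$, and $\Delta_{u,i}f(\mathbf{x})+\Delta_{u,j}f(\mathbf{x})\ge0$ for $i\ne j$; monotone if $\mathbf{x}\preceq\mathbf{y}\Rightarrow f(\mathbf{x})\le f(\mathbf{y})$. $F$ is $\varepsilon$-approximately diminishing returns if there is a monotone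 $k$-submodular $f$ with $f(\mathbf{0})=0$ and $(1-\varepsilon)\Delta_{u,i}f(\mathbf{x})\le\Delta_{u,i}F(\mathbf{x})\le(1+\varepsilon)\Delta_{u,i}f(\mathbf{x})$ for all $\mathbf{x}$, $u\notin\mathrm{supp}(\mathbf{x})$, $i$; $F(\mathbf{0})=0$. $k$-Greedy-TS: $\mathbf{x}^{(0)}=\mathbf{0}$; for $j=1,\dots,B$ pick $(e^{(j)},i^{(j)})\in\arg\max_{e\notin\mathrm{supp}(\mathbf{x}^{(j-1)}),i\in[k]}\Delta_{e,i}F(\mathbf{x}^{(j-1)})$ (ties arbitrary), set $\mathbf{x}^{(j)}$ to be $\mathbf{x}^{(j-1)}$ with $e^{(j)}$ added to the $i^{(j)}$-th set; output $\mathbf{x}^{(B)}$. *)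

theory Defs
  imports Complex_Main "HOL-Library.Disjoint_Sets"
begin

(* A k-tuple (X_1, ..., X_k) of sets is a function x with x i = X_i for i in {1..k}.
   Outside {1..k} it is forced to be empty, so that distinct elements of ktuples V k are
   distinct tuples (in particular ktuples V k is finite when V is). *)
definition ktuples :: "'a set \<Rightarrow> nat \<Rightarrow> (nat \<Rightarrow> 'a set) set" where
  "ktuples V k = {x. (\<forall>i\<in>{1..k}. x i \<subseteq> V) \<and> disjoint_family_on x {1..k} \<and>
                     (\<forall>i. i \<notin> {1..k} \<longrightarrow> x i = {})}"

definition kzero :: "nat \<Rightarrow> 'a set" where
  "kzero = (\<lambda>i. {})"

definition ksupp :: "nat \<Rightarrow> (nat \<Rightarrow> 'a set) \<Rightarrow> 'a set" where
  "ksupp k x = (\<Union>i\<in>{1..k}. x i)"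

definition kle :: "nat \<Rightarrow> (nat \<Rightarrow> 'a set) \<Rightarrow> (nat \<Rightarrow> 'a set) \<Rightarrow> bool" where
  "kle k x y \<longleftrightarrow> (\<forall>i\<in>{1..k}. x i \<subseteq> y i)"

definition kadd :: "(nat \<Rightarrow> 'a set) \<Rightarrow> 'a \<Rightarrow> nat \<Rightarrow> (nat \<Rightarrow> 'a set)" where
  "kadd x u i = x(i := x i \<union> {u})"

definition marginal :: "((nat \<Rightarrow> 'a set) \<Rightarrow> real) \<Rightarrow> 'a \<Rightarrow> nat \<Rightarrow> (nat \<Rightarrow> 'a set) \<Rightarrow> real" where
  "marginal g u i x = g (kadd x u i) - g x"

definition k_submodular :: "'a set \<Rightarrow> nat \<Rightarrow> ((nat \<Rightarrow> 'a set) \<Rightarrow> real) \<Rightarrow> bool" where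
  "k_submodular V k f \<longleftrightarrow>
     (\<forall>x\<in>ktuples V k. \<forall>y\<in>ktuples V k. \<forall>u\<in>V - ksupp k y. \<forall>i\<in>{1..k}.
        kle k x y \<longrightarrow> marginal f u i x \<ge> marginal f u i y) \<and>
     (\<forall>x\<in>ktuples V k. \<forall>u\<in>V - ksupp k x. \<forall>i\<in>{1..k}. \<forall>j\<in>{1..k}.
        i \<noteq> j \<longrightarrow> marginal f u i x + marginal f u j x \<ge> 0)"

definition k_monotone :: "'a set \<Rightarrow> nat \<Rightarrow> ((nat \<Rightarrow> 'a set) \<Rightarrow> real) \<Rightarrow> bool" where
  "k_monotone V k f \<longleftrightarrow>
     (\<forall>x\<in>ktuples V k. \<forall>y\<in>ktuples V k. kle k x y \<longrightarrow> f x \<le> f y)"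

definition approx_diminishing_returns ::
    "'a set \<Rightarrow> nat \<Rightarrow> real \<Rightarrow> ((nat \<Rightarrow> 'a set) \<Rightarrow> real) \<Rightarrow> bool" where
  "approx_diminishing_returns V k \<epsilon> F \<longleftrightarrow>
     F kzero = 0 \<and>
     (\<exists>f. k_monotone V k f \<and> k_submodular V k f \<and> f kzero = 0 \<and>
        (\<forall>x\<in>ktuples V k. \<forall>u\<in>V - ksupp k x. \<forall>i\<in>{1..k}.
           (1 - \<epsilon>) * marginal f u i x \<le> marginal F u i x \<and>
           marginal F u i x \<le> (1 + \<epsilon>) * marginal f u i x))"

(* k_greedy_ts V k F j x: x is a possible value of the iterate after j steps,
   for some way of breaking ties. *)
inductive k_greedy_ts ::
    "'a set \<Rightarrow> nat \<Rightarrow> ((nat \<Rightarrow> 'a set) \<Rightarrow> real) \<Rightarrow> nat \<Rightarrow> (nat \<Rightarrow> 'a set) \<Rightarrow> bool"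
  for V :: "'a set" and k :: nat and F :: "(nat \<Rightarrow> 'a set) \<Rightarrow> real" where
  init: "k_greedy_ts V k F 0 kzero"
| step: "k_greedy_ts V k F (Suc j) (kadd x e i)"
    if "k_greedy_ts V k F j x"
    and "is_arg_max (\<lambda>(e, i). marginal F e i x) (\<lambda>(e, i). e \<in> V - ksupp k x \<and> i \<in> {1..k}) (e, i)"

end

theory Submission
  imports Defs
begin

text \<open>
  Exchange argument: a competitor \<open>y\<close> dominating the greedy iterate is carried along, and when
  greedy adds \<open>e\<close>, some \<open>a\<close> of \<open>y\<close> outside the iterate is exchanged for \<open>e\<close>. By
  monotonicity the loss is at most the marginal of \<open>a\<close> at \<open>y\<close> without \<open>a\<close>, which diminishing
  returns of \<open>f\<close> and the greedy choice bound by \<open>(1 + \<epsilon>) / (1 - \<epsilon>)\<close> times the greedy gain.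
  Measuring this loss in \<open>F\<close> rather than in \<open>f\<close> is what avoids an extra factor \<open>1 + \<epsilon>\<close>: after
  \<open>B\<close> steps \<open>y\<close> is the greedy output \<open>x\<close>, so the initial competitor has value at most
  \<open>F x + (1 + \<epsilon>) / (1 - \<epsilon>) * F x = 2 / (1 - \<epsilon>) * F x\<close>.
\<close>

text \<open>Deleting \<open>a\<close> from every component avoids naming its index; in a member of
  \<open>ktuples V k\<close> at most one component contains it.\<close>

definition kremove :: "(nat \<Rightarrow> 'a set) \<Rightarrow> 'a \<Rightarrow> (nat \<Rightarrow> 'a set)" where
  "kremove y a = (\<lambda>i. y i - {a})"

section \<open>Tuples: insertion, deletion, order and supports\<close>

lemma kzero_in_ktuples: "kzero \<in> ktuples V k"
  by (simp add: kzero_def ktuples_def disjoint_family_on_def)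

lemma finite_ktuples:
  assumes "finite V"
  shows "finite (ktuples V k)"
proof (rule finite_subset)
  show "ktuples V k \<subseteq>
      {x. \<forall>i. (i \<in> {1..k} \<longrightarrow> x i \<in> Pow V) \<and> (i \<notin> {1..k} \<longrightarrow> x i = {})}"
    by (auto simp: ktuples_def)
  show "finite {x. \<forall>i. (i \<in> {1..k} \<longrightarrow> x i \<in> Pow V) \<and> (i \<notin> {1..k} \<longrightarrow> x i = {})}"
    using assms by (intro finite_set_of_finite_funs) auto
qed

lemma ksupp_subset: "x \<in> ktuples V k \<Longrightarrow> ksupp k x \<subseteq> V"
  by (auto simp: ktuples_def ksupp_def)

lemma ksupp_kzero: "ksupp k kzero = {}"
  by (simp add: ksupp_def kzero_def)

lemma ksupp_kadd: "i \<in> {1..k} \<Longrightarrow> ksupp k (kadd x u i) = insert u (ksupp k x)"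
  by (auto simp: ksupp_def kadd_def split: if_splits)

lemma ksupp_kremove: "ksupp k (kremove y a) = ksupp k y - {a}"
  by (auto simp: ksupp_def kremove_def)

lemma kadd_in_ktuples:
  assumes "x \<in> ktuples V k" "u \<in> V - ksupp k x" "i \<in> {1..k}"
  shows "kadd x u i \<in> ktuples V k"
  using assms by (fastforce simp: ktuples_def ksupp_def kadd_def disjoint_family_on_def)

lemma kremove_in_ktuples: "y \<in> ktuples V k \<Longrightarrow> kremove y a \<in> ktuples V k"
  by (fastforce simp: ktuples_def kremove_def disjoint_family_on_def)

lemma ktuples_index_unique:
  assumes "y \<in> ktuples V k" "a \<in> y i" "a \<in> y j"
  shows "i = j"
proof (rule ccontr)
  assume "i \<noteq> j"
  moreover have "i \<in> {1..k}" "j \<in> {1..k}"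
    using assms by (auto simp: ktuples_def)
  ultimately have "y i \<inter> y j = {}"
    using assms(1) unfolding ktuples_def disjoint_family_on_def by blast
  then show False
    using assms by blast
qed

lemma kadd_kremove:
  assumes "y \<in> ktuples V k" "a \<in> y i"
  shows "kadd (kremove y a) a i = y"
proof
  fix j
  have "a \<notin> y j" if "j \<noteq> i"
    using ktuples_index_unique[OF assms] that by blast
  then show "kadd (kremove y a) a i j = y j"
    using assms by (auto simp: kadd_def kremove_def)
qed

lemma kle_kzero: "kle k kzero y"
  by (simp add: kle_def kzero_def)

lemma kle_kadd: "kle k x (kadd x e i)"
  by (auto simp: kle_def kadd_def)

lemma kadd_mono: "kle k x y \<Longrightarrow> kle k (kadd x e i) (kadd y e i)"
  by (auto simp: kle_def kadd_def)

lemma kle_kremove: "kle k x y \<Longrightarrow> a \<notin> ksupp k x \<Longrightarrow> kle k x (kremove y a)"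
  by (auto simp: kle_def kremove_def ksupp_def)

lemma ksupp_mono: "kle k x y \<Longrightarrow> ksupp k x \<subseteq> ksupp k y"
  by (auto simp: kle_def ksupp_def)

text \<open>An element of \<open>y i\<close> lies in some \<open>x j\<close>, hence in
  \<open>y j\<close>, and disjointness forces \<open>i = j\<close>. This finally identifies the
  competitor with the greedy output.\<close>

lemma kle_ksupp_imp_eq:
  assumes "x \<in> ktuples V k" "y \<in> ktuples V k" "kle k x y" "ksupp k y \<subseteq> ksupp k x"
  shows "x = y"
proof
  fix i
  show "x i = y i"
  proof (cases "i \<in> {1..k}")
    case True
    have "a \<in> x i" if a: "a \<in> y i" for a
    proof -
      have "a \<in> ksupp k x"
        using a True assms(4) unfolding ksupp_def by blast
      then obtain j where j: "j \<in> {1..k}" "a \<in> x j"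
        by (auto simp: ksupp_def)
      then have "a \<in> y j"
        using assms(3) by (auto simp: kle_def)
      then have "i = j"
        using ktuples_index_unique[OF assms(2) a] by blast
      then show ?thesis
        using j by simp
    qed
    then show ?thesis
      using True assms(3) by (auto simp: kle_def)
  next
    case False
    then show ?thesis
      using assms by (auto simp: ktuples_def)
  qed
qed

section \<open>Greedy iterates and the marginals of \<open>F\<close>\<close>

lemma k_greedy_ts_in_ktuples:
  assumes "k_greedy_ts V k F j x" "finite V"
  shows "x \<in> ktuples V k \<and> card (ksupp k x) = j"
  using assms(1)
proof induction
  case init
  then show ?case
    by (simp add: kzero_in_ktuples ksupp_kzero)
next
  case (step j x e i)
  then have "e \<in> V - ksupp k x" "i \<in> {1..k}"
    by (auto simp: is_arg_max_def)
  moreover have "finite (ksupp k x)"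
    using step ksupp_subset assms(2) by (metis finite_subset)
  ultimately show ?case
    using step by (simp add: kadd_in_ktuples ksupp_kadd)
qed

text \<open>Only \<open>f\<close> is assumed monotone; its nonnegative marginals pass to
  \<open>F\<close> through the lower bound, as \<open>1 - \<epsilon>\<close> is positive.\<close>

lemma approx_marginal_nonneg:
  assumes "approx_diminishing_returns V k \<epsilon> F" "\<epsilon> < 1"
    and x: "x \<in> ktuples V k" "u \<in> V - ksupp k x" "i \<in> {1..k}"
  shows "0 \<le> marginal F u i x"
proof -
  obtain f where mono: "k_monotone V k f"
    and lower: "(1 - \<epsilon>) * marginal f u i x \<le> marginal F u i x"
    using assms by (auto simp: approx_diminishing_returns_def)
  have "0 \<le> marginal f u i x"
    using mono x kadd_in_ktuples[OF x] by (simp add: k_monotone_def marginal_def kle_kadd)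
  then have "0 \<le> (1 - \<epsilon>) * marginal f u i x"
    using assms(2) by simp
  with lower show ?thesis
    by linarith
qed

text \<open>The comparison passes through \<open>f\<close>: upper bound at \<open>y\<close>,
  diminishing returns of \<open>f\<close>, lower bound at \<open>x\<close>. The factor
  \<open>1 - \<epsilon>\<close> on the left avoids a division.\<close>

lemma approx_marginal_antimono:
  assumes "approx_diminishing_returns V k \<epsilon> F" "0 < \<epsilon>" "\<epsilon> < 1"
    and "x \<in> ktuples V k" "y \<in> ktuples V k" "kle k x y" "u \<in> V - ksupp k y" "i \<in> {1..k}"
  shows "(1 - \<epsilon>) * marginal F u i y \<le> (1 + \<epsilon>) * marginal F u i x"
proof -
  have u: "u \<in> V - ksupp k x"
    using assms ksupp_mono by blast
  obtain f where sub: "k_submodular V k f"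
    and bounds: "\<And>x. x \<in> ktuples V k \<Longrightarrow> u \<in> V - ksupp k x \<Longrightarrow>
        (1 - \<epsilon>) * marginal f u i x \<le> marginal F u i x \<and>
        marginal F u i x \<le> (1 + \<epsilon>) * marginal f u i x"
    using assms by (auto simp: approx_diminishing_returns_def)
  have "marginal f u i y \<le> marginal f u i x"
    using sub assms unfolding k_submodular_def by blast
  then have "marginal F u i y \<le> (1 + \<epsilon>) * marginal f u i x"
    using bounds[of y] assms by (smt (verit) mult_left_mono)
  then have "(1 - \<epsilon>) * marginal F u i y \<le> (1 + \<epsilon>) * ((1 - \<epsilon>) * marginal f u i x)"
    using assms(3) mult_left_mono[of _ _ "1 - \<epsilon>"] by (simp add: mult.left_commute)
  also have "\<dots> \<le> (1 + \<epsilon>) * marginal F u i x"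
    using bounds[OF assms(4) u] assms(2) by (intro mult_left_mono) auto
  finally show ?thesis .
qed

section \<open>The exchange and the greedy invariant\<close>

lemma greedy_exchange:
  assumes F: "approx_diminishing_returns V k \<epsilon> F" "0 < \<epsilon>" "\<epsilon> < 1"
    and xy: "x \<in> ktuples V k" "y \<in> ktuples V k" "kle k x y"
    and a: "a \<in> ksupp k y" "a \<notin> ksupp k x"
    and e: "e \<in> V - ksupp k (kremove y a)" "i \<in> {1..k}"
    and max: "\<And>l. l \<in> {1..k} \<Longrightarrow> marginal F a l x \<le> marginal F e i x"
  shows "(1 - \<epsilon>) * F y \<le> (1 - \<epsilon>) * F (kadd (kremove y a) e i) + (1 + \<epsilon>) * marginal F e i x"
proof -
  obtain l where l: "l \<in> {1..k}" "a \<in> y l"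
    using a by (auto simp: ksupp_def)
  let ?z = "kremove y a"
  \<comment> \<open>Since \<open>a\<close> lies outside the support of \<open>x\<close>, deleting it
    keeps the competitor above \<open>x\<close>, so diminishing returns apply to \<open>x\<close>
    and \<open>?z\<close>. The case \<open>e = a\<close> is included: the exchange then merely puts
    \<open>e\<close> into component \<open>i\<close>.\<close>
  have z: "?z \<in> ktuples V k" "kle k x ?z" "a \<in> V - ksupp k ?z"
    using xy a ksupp_subset[OF xy(2)]
    by (auto simp: kremove_in_ktuples kle_kremove ksupp_kremove)
  have "F y = F ?z + marginal F a l ?z"
    using kadd_kremove[OF xy(2) l(2)] by (simp add: marginal_def)
  then have "(1 - \<epsilon>) * F y = (1 - \<epsilon>) * F ?z + (1 - \<epsilon>) * marginal F a l ?z"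
    by (simp add: distrib_left)
  moreover have "(1 - \<epsilon>) * F ?z \<le> (1 - \<epsilon>) * F (kadd ?z e i)"
    using approx_marginal_nonneg[OF F(1,3) z(1) e] F(3)
    by (intro mult_left_mono) (auto simp: marginal_def)
  moreover have "(1 - \<epsilon>) * marginal F a l ?z \<le> (1 + \<epsilon>) * marginal F a l x"
    using F xy z l by (intro approx_marginal_antimono) auto
  moreover have "(1 + \<epsilon>) * marginal F a l x \<le> (1 + \<epsilon>) * marginal F e i x"
    using max[OF l(1)] F(2) by (intro mult_left_mono) auto
  ultimately show ?thesis
    by linarith
qed

text \<open>Induction along the greedy run, starting from \<open>z\<close> itself as competitor. The
  losses are multiples of the greedy gains, which telescope to \<open>F x\<close> because
  \<open>F kzero = 0\<close>.\<close>

lemma greedy_competitor: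
  assumes "k_greedy_ts V k F j x" "finite V"
    and F: "approx_diminishing_returns V k \<epsilon> F" "0 < \<epsilon>" "\<epsilon> < 1"
    and "z \<in> ktuples V k" "card (ksupp k z) \<le> B" "j \<le> B"
  shows "\<exists>y\<in>ktuples V k. kle k x y \<and> card (ksupp k y) \<le> B \<and>
           (1 - \<epsilon>) * F z \<le> (1 - \<epsilon>) * F y + (1 + \<epsilon>) * F x"
  using assms(1,8)
proof induction
  case init
  then show ?case
    using assms F(1) by (auto simp: kle_kzero approx_diminishing_returns_def)
next
  case (step j x e i)
  then obtain y where y: "y \<in> ktuples V k" "kle k x y" "card (ksupp k y) \<le> B"
    and val: "(1 - \<epsilon>) * F z \<le> (1 - \<epsilon>) * F y + (1 + \<epsilon>) * F x"
    by auto
  have x: "x \<in> ktuples V k" "card (ksupp k x) = j"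
    using k_greedy_ts_in_ktuples step.hyps(1) assms(2) by blast+
  have ei: "e \<in> V - ksupp k x" "i \<in> {1..k}"
    and max: "\<And>e' i'. e' \<in> V - ksupp k x \<Longrightarrow> i' \<in> {1..k} \<Longrightarrow> marginal F e' i' x \<le> marginal F e i x"
    using step.hyps(2) by (auto simp: is_arg_max_def not_less)
  have gain: "(1 + \<epsilon>) * F (kadd x e i) = (1 + \<epsilon>) * F x + (1 + \<epsilon>) * marginal F e i x"
    by (simp add: marginal_def algebra_simps)
  have fin: "finite (ksupp k y)"
    using y ksupp_subset assms(2) by (metis finite_subset)
  show ?case
  \<comment> \<open>A competitor with room for a new \<open>e\<close> absorbs it without loss;
    otherwise an exchange keeps its support within \<open>B\<close>.\<close>
  proof (cases "e \<notin> ksupp k y \<and> card (ksupp k y) < B")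
    case True
    then have e: "e \<in> V - ksupp k y"
      using ei by auto
    have "(1 - \<epsilon>) * F y \<le> (1 - \<epsilon>) * F (kadd y e i)"
      using approx_marginal_nonneg[OF F(1,3) y(1) e ei(2)] F(3)
      by (intro mult_left_mono) (auto simp: marginal_def)
    moreover have "0 \<le> (1 + \<epsilon>) * marginal F e i x"
      using approx_marginal_nonneg[OF F(1,3) x(1) ei] F(2) by simp
    ultimately have "(1 - \<epsilon>) * F z \<le> (1 - \<epsilon>) * F (kadd y e i) + (1 + \<epsilon>) * F (kadd x e i)"
      using val gain by linarith
    moreover have "card (ksupp k (kadd y e i)) \<le> B"
      using True fin ei(2) by (simp add: ksupp_kadd)
    ultimately show ?thesis
      using kadd_in_ktuples[OF y(1) e ei(2)] kadd_mono[OF y(2)] by blast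
  next
    case False
    \<comment> \<open>If \<open>e\<close> already occurs in \<open>y\<close>, possibly in another
      component, take \<open>a = e\<close>. Otherwise \<open>y\<close> has \<open>B\<close> elements
      while \<open>x\<close> has only \<open>j < B\<close>, so some element of \<open>y\<close> is
      not in \<open>x\<close>.\<close>
    obtain a where a: "a \<in> ksupp k y" "a \<notin> ksupp k x" and e: "e \<in> V - ksupp k (kremove y a)"
    proof (cases "e \<in> ksupp k y")
      case True
      then show ?thesis
        using that[of e] ei by (auto simp: ksupp_kremove)
    next
      assume e: "e \<notin> ksupp k y"
      then have "card (ksupp k x) < card (ksupp k y)"
        using False x step.prems by simp
      then have "\<not> ksupp k y \<subseteq> ksupp k x"
        using card_mono x(1) ksupp_subset assms(2) by (metis finite_subset leD)
      then show ?thesis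
        using that e ei by (auto simp: ksupp_kremove)
    qed
    let ?y = "kadd (kremove y a) e i"
    have "marginal F a l x \<le> marginal F e i x" if "l \<in> {1..k}" for l
      using max that a ksupp_subset[OF y(1)] by auto
    then have "(1 - \<epsilon>) * F y \<le> (1 - \<epsilon>) * F ?y + (1 + \<epsilon>) * marginal F e i x"
      by (rule greedy_exchange[OF F x(1) y(1,2) a e ei(2)])
    then have "(1 - \<epsilon>) * F z \<le> (1 - \<epsilon>) * F ?y + (1 + \<epsilon>) * F (kadd x e i)"
      using val gain by linarith
    moreover have "?y \<in> ktuples V k" "kle k (kadd x e i) ?y"
      using y a e ei by (simp_all add: kadd_in_ktuples kremove_in_ktuples kadd_mono kle_kremove)
    moreover have "card (ksupp k ?y) \<le> B"
    proof -
      have "card (ksupp k ?y) \<le> Suc (card (ksupp k y - {a}))"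
        using ei(2) by (simp add: ksupp_kadd ksupp_kremove card_insert_if fin)
      also have "\<dots> = card (ksupp k y)"
        using fin a(1) by (rule card_Suc_Diff1)
      finally show ?thesis
        using y(3) by simp
    qed
    ultimately show ?thesis
      by blast
  qed
qed

theorem theorem5:
  fixes n k B :: nat and \<epsilon> :: real
    and F :: "(nat \<Rightarrow> nat set) \<Rightarrow> real" and x :: "nat \<Rightarrow> nat set"
  assumes "k \<ge> 1"
    and "0 < \<epsilon>" and "\<epsilon> < 1"
    and "B \<ge> 1" and "B \<le> n"
    and "\<And>y. y \<in> ktuples {1..n} k \<Longrightarrow> F y \<ge> 0"
    and "approx_diminishing_returns {1..n} k \<epsilon> F"
    and "k_greedy_ts {1..n} k F B x"
  shows "F x \<ge> (1 - \<epsilon>) / 2 * Max (F ` {y \<in> ktuples {1..n} k. card (ksupp k y) \<le> B})"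
proof -
  let ?V = "{1..n}"
  have x: "x \<in> ktuples ?V k" "card (ksupp k x) = B"
    using k_greedy_ts_in_ktuples assms(8) by blast+
  have bound: "(1 - \<epsilon>) / 2 * F z \<le> F x" if z: "z \<in> ktuples ?V k" "card (ksupp k z) \<le> B" for z
  proof -
    obtain y where y: "y \<in> ktuples ?V k" "kle k x y" "card (ksupp k y) \<le> B"
      and val: "(1 - \<epsilon>) * F z \<le> (1 - \<epsilon>) * F y + (1 + \<epsilon>) * F x"
      using greedy_competitor[OF assms(8) _ assms(7,2,3) z] by auto
    have "finite (ksupp k y)"
      using ksupp_subset[OF y(1)] finite_subset by blast
    \<comment> \<open>The greedy output already has \<open>B\<close> support elements, which leaves
      the competitor above it no room for more.\<close>
    then have "ksupp k x = ksupp k y"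
      using ksupp_mono[OF y(2)] x(2) y(3) by (intro card_seteq) auto
    then have "x = y"
      using x y by (intro kle_ksupp_imp_eq) auto
    \<comment> \<open>With \<open>y = x\<close> the two terms of \<open>val\<close> add up:
      \<open>(1 - \<epsilon>) + (1 + \<epsilon>) = 2\<close>.\<close>
    then show ?thesis
      using val by (simp add: algebra_simps)
  qed
  let ?S = "{y \<in> ktuples ?V k. card (ksupp k y) \<le> B}"
  have "kzero \<in> ?S"
    by (simp add: kzero_in_ktuples ksupp_kzero)
  then have "Max (F ` ?S) \<in> F ` ?S"
    by (intro Max_in) (auto simp: finite_ktuples)
  then show ?thesis
    using bound by auto
qed

end
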